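(* Let $\Omega\subset\mathbb{R}^2$ be a simply connected polygonal domain with a triangulation $\mathcal{T}_h$ of $\overline{\Omega}$ into uniform squares of side $h$, satisfying the standing mesh assumption stated in the context, whose squares are colored red and black like a checkerboard. For each interior red square $Q_R$ and each interior black square $Q_K$, $$(\nabla\mathbf{\Psi}_h^{Q_R},\nabla\mathbf{\Psi}_h^{Q_K})=0,$$ where $(\nabla\mathbf{v}_h,\nabla\mathbf{w}_h)=\sum_{Q\in\mathcal{T}_h}\int_Q\nabla\mathbf{v}_h:\nabla\mathbf{w}_h\,dx\,dy$ is the piecewise (elementwise) inner product of gradients.
   Context: Mesh: $\mathcal{T}_h$ is a (finite) triangulation of $\overline{\Omega}$ into uniform squares of width and height $h$ (sides parallel to the coordinate axes). A vertex or edge of $\mathcal{T}_h$ is a boundary vertex or edge if it belongs to $\partial\Omega$; otherwise it is an interior vertex or edge. A square of $\mathcal{T}_h$ is an interior square if all its 4 vertices are interior vertices. Standing mesh assumption: no square has 4 boundary vertices; no interior edge meets 2 boundary vertices; if a square has only two boundary vertices, they are the two endpoints of one edge. Coloring: the squares of $\mathcal{T}_h$ are partitioned into red squares and black squares so that squares sharing at least one edge have different colors (a checkerboard). $P_1$-nonconforming spaces: $\mathcal{NC}^h(\Omega)$ is the set of $v_h\in L^2(\Omega)$ such that $v_h|_Q\in\mathrm{span}\{1,x,y\}$ for every square $Q\in\mathcal{T}_h$ and $v_h$ is continuous at every midpoint of the edges of $\mathcal{T}_h$. $\mathcal{NC}^h_0(\Omega)$ is the subspace of those $v_h\in\mathcal{NC}^h(\Omega)$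 with $v_h(m)=0$ for all midpoints $m$ of boundary edges. A function in $\mathcal{NC}^h(\Omega)$ is determined by its values at the midpoints of edges, and prescribed values $c_m$ at midpoints are attained by some function in $\mathcal{NC}^h(\Omega)$ if and only if on every square with clockwise numbered edge midpoints $m_1,\dots,m_4$ one has $c_{m_1}+c_{m_3}=c_{m_2}+c_{m_4}$. For an interior vertex $\mathbf{V}$ and $(a,b)\in\mathbb{R}^2$, $\psi^{\mathbf{V}}[a,b]\in[\mathcal{NC}^h_0(\Omega)]^2$ is the function whose value at the midpoint $m$ of an edge of $\mathcal{T}_h$ is $(a,b)$ if the edge meets $\mathbf{V}$ (i.e. has $\mathbf{V}$ as an endpoint), and $(0,0)$ otherwise. For a square $Q$, denote by $\mathbf{V}^{rt}(Q),\mathbf{V}^{lt}(Q),\mathbf{V}^{lb}(Q),\mathbf{V}^{rb}(Q)$ its right-top, left-top, left-bottom, right-bottom vertices. For an interior square $Q$, $$\mathbf{\Psi}_h^Q=\psi^{\mathbf{V}^{rt}(Q)}[\tfrac12,-\tfrac12]+\psi^{\mathbf{V}^{lt}(Q)}[\tfrac12,\tfrac12]+\psi^{\mathbf{V}^{lb}(Q)}[-\tfrac12,\tfrac12]+\psi^{\mathbf{V}^{rb}(Q)}[-\tfrac12,-\tfrac12].$$ *)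

theory Defs
  imports "HOL-Analysis.Analysis"
begin

type_synonym point = "real^2"

(* No boundary regularity (Lipschitz, absence of slits) is imposed beyond this. *)
definition polygonal_domain :: "point set \<Rightarrow> bool" where
  "polygonal_domain \<Omega> \<longleftrightarrow>
     open \<Omega> \<and> connected \<Omega> \<and> \<Omega> \<noteq> {} \<and> bounded \<Omega> \<and>
     (\<exists>S. finite S \<and> (\<forall>(a, b)\<in>S. a \<noteq> b) \<and> frontier \<Omega> = (\<Union>(a, b)\<in>S. closed_segment a b))"


(* For fixed h, a square is identified with its left-bottom vertex p; a mesh is a set T of such
   points p. *)
definition square :: "real \<Rightarrow> point \<Rightarrow> point set" where
  "square h p = cbox p (p + vector [h, h])"

definition v_lb :: "real \<Rightarrow> point \<Rightarrow> point" where "v_lb h p = p"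
definition v_rb :: "real \<Rightarrow> point \<Rightarrow> point" where "v_rb h p = p + vector [h, 0]"
definition v_lt :: "real \<Rightarrow> point \<Rightarrow> point" where "v_lt h p = p + vector [0, h]"
definition v_rt :: "real \<Rightarrow> point \<Rightarrow> point" where "v_rt h p = p + vector [h, h]"

definition vertices :: "real \<Rightarrow> point \<Rightarrow> point set" where
  "vertices h p = {v_rt h p, v_lt h p, v_lb h p, v_rb h p}"

(* An edge is the pair of its endpoints, always listed from left to right or from bottom to top,
   so that an edge shared by two squares is the same pair for both. *)
definition edges :: "real \<Rightarrow> point \<Rightarrow> (point \<times> point) set" where
  "edges h p = {(v_lb h p, v_rb h p), (v_lt h p, v_rt h p),
                (v_lb h p, v_lt h p), (v_rb h p, v_rt h p)}"

definition mesh_edges :: "real \<Rightarrow> point set \<Rightarrow> (point \<times> point) set" where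
  "mesh_edges h T = (\<Union>p\<in>T. edges h p)"

(* Conforming: two different squares are disjoint or meet exactly in a common vertex or edge. *)
definition square_triangulation :: "point set \<Rightarrow> real \<Rightarrow> point set \<Rightarrow> bool" where
  "square_triangulation \<Omega> h T \<longleftrightarrow>
     h > 0 \<and> finite T \<and> (\<Union>p\<in>T. square h p) = closure \<Omega> \<and>
     (\<forall>p\<in>T. \<forall>q\<in>T. p \<noteq> q \<longrightarrow>
        square h p \<inter> square h q = {} \<or>
        (\<exists>v \<in> vertices h p \<inter> vertices h q. square h p \<inter> square h q = {v}) \<or>
        (\<exists>(u, w) \<in> edges h p \<inter> edges h q. square h p \<inter> square h q = closed_segment u w))"

definition boundary_edge :: "point set \<Rightarrow> point \<times> point \<Rightarrow> bool" where
  "boundary_edge \<Omega> e \<longleftrightarrow> closed_segment (fst e) (snd e) \<subseteq> frontier \<Omega>"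

definition boundary_vertices :: "point set \<Rightarrow> real \<Rightarrow> point \<Rightarrow> point set" where
  "boundary_vertices \<Omega> h p = vertices h p \<inter> frontier \<Omega>"

definition interior_square :: "point set \<Rightarrow> real \<Rightarrow> point set \<Rightarrow> point \<Rightarrow> bool" where
  "interior_square \<Omega> h T p \<longleftrightarrow> p \<in> T \<and> boundary_vertices \<Omega> h p = {}"

definition mesh_assumption :: "point set \<Rightarrow> real \<Rightarrow> point set \<Rightarrow> bool" where
  "mesh_assumption \<Omega> h T \<longleftrightarrow>
     (\<forall>p\<in>T. card (boundary_vertices \<Omega> h p) \<noteq> 4) \<and>
     (\<forall>(u, w)\<in>mesh_edges h T. \<not> boundary_edge \<Omega> (u, w) \<longrightarrow>
        \<not> (u \<in> frontier \<Omega> \<and> w \<in> frontier \<Omega>)) \<and>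
     (\<forall>p\<in>T. card (boundary_vertices \<Omega> h p) = 2 \<longrightarrow>
        (\<exists>(u, w)\<in>edges h p. boundary_vertices \<Omega> h p = {u, w}))"

definition checkerboard :: "real \<Rightarrow> point set \<Rightarrow> point set \<Rightarrow> point set \<Rightarrow> bool" where
  "checkerboard h T Red Black \<longleftrightarrow>
     Red \<union> Black = T \<and> Red \<inter> Black = {} \<and>
     (\<forall>p\<in>T. \<forall>q\<in>T. p \<noteq> q \<and> edges h p \<inter> edges h q \<noteq> {} \<longrightarrow> (p \<in> Red \<longleftrightarrow> q \<in> Black))"


(* Elements of L^2 are represented by functions that are affine at every point of each open square
   and whose value at an edge midpoint m is the limit, at m, of the values on the open squares;
   so v m is the common midpoint value of the pieces around m. The values at the other points of
   the edges are unconstrained: they form a null set. *)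
definition NC :: "point set \<Rightarrow> real \<Rightarrow> point set \<Rightarrow> (point \<Rightarrow> real) set" where
  "NC \<Omega> h T = {v.
     v \<in> borel_measurable (lebesgue_on \<Omega>) \<and> integrable (lebesgue_on \<Omega>) (\<lambda>x. (v x)\<^sup>2) \<and>
     (\<forall>p\<in>T. \<exists>a b c. \<forall>x\<in>interior (square h p). v x = a + b * x$1 + c * x$2) \<and>
     (\<forall>(u, w)\<in>mesh_edges h T.
        continuous (at (midpoint u w) within
                      insert (midpoint u w) (\<Union>p\<in>T. interior (square h p))) v)}"

definition NC0 :: "point set \<Rightarrow> real \<Rightarrow> point set \<Rightarrow> (point \<Rightarrow> real) set" where
  "NC0 \<Omega> h T = {v \<in> NC \<Omega> h T.
     \<forall>(u, w)\<in>mesh_edges h T. boundary_edge \<Omega> (u, w) \<longrightarrow> v (midpoint u w) = 0}"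

definition NC0_vec :: "point set \<Rightarrow> real \<Rightarrow> point set \<Rightarrow> (point \<Rightarrow> real^2) set" where
  "NC0_vec \<Omega> h T = {v. \<forall>i. (\<lambda>x. v x $ i) \<in> NC0 \<Omega> h T}"

(* The midpoint values determine the function on all open squares, i.e. up to a null set. *)
definition psi :: "point set \<Rightarrow> real \<Rightarrow> point set \<Rightarrow> point \<Rightarrow> real^2 \<Rightarrow> (point \<Rightarrow> real^2)" where
  "psi \<Omega> h T V c = (SOME v. v \<in> NC0_vec \<Omega> h T \<and>
     (\<forall>(u, w)\<in>mesh_edges h T. v (midpoint u w) = (if V = u \<or> V = w then c else 0)))"

definition Psi :: "point set \<Rightarrow> real \<Rightarrow> point set \<Rightarrow> point \<Rightarrow> (point \<Rightarrow> real^2)" where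
  "Psi \<Omega> h T p = (\<lambda>x.
     psi \<Omega> h T (v_rt h p) (vector [1/2, -1/2]) x +
     psi \<Omega> h T (v_lt h p) (vector [1/2, 1/2]) x +
     psi \<Omega> h T (v_lb h p) (vector [-1/2, 1/2]) x +
     psi \<Omega> h T (v_rb h p) (vector [-1/2, -1/2]) x)"

(* The inner product of real^2^2 is the Frobenius product of matrices. The functions need not be
   differentiable on the edges, which are null sets. *)
definition grad_inner :: "real \<Rightarrow> point set \<Rightarrow> (point \<Rightarrow> real^2) \<Rightarrow> (point \<Rightarrow> real^2) \<Rightarrow> real" where
  "grad_inner h T v w =
     (\<Sum>p\<in>T. integral (square h p) (\<lambda>x. jacobian v (at x) \<bullet> jacobian w (at x)))"

end

theory Submission
  imports Defs
begin

text \<open>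
  The two functions are orthogonal not only globally but on every single square, because the
  colour of a square \<open>p\<close> relative to \<open>Q\<close> dictates the shape of the constant \<open>2 \<times> 2\<close> matrix
  \<open>\<nabla>\<Psi>\<^sup>Q\<close> on \<open>p\<close>. Write \<open>u = \<Psi>\<^sup>Q\<close>, with components \<open>u\<^sub>1, u\<^sub>2\<close>.

  \<^item> If \<open>p\<close> has the colour of \<open>Q\<close>, then \<open>\<partial>\<^sub>x u\<^sub>2 + \<partial>\<^sub>y u\<^sub>1 = 0\<close> on \<open>p\<close>.
  \<^item> If \<open>p\<close> has the other colour, then on \<open>p\<close> the gradient is a multiple of the matrix with
    zero diagonal and both off-diagonal entries \<open>1\<close>.

  These two kinds of matrices are orthogonal for the Frobenius product. When \<open>R\<close> is red and \<open>K\<close>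
  is black, every square has the colour of exactly one of them, so the integrand vanishes on
  every open square.

  The dichotomy (\<open>Psi_gradient_by_colour\<close>) is a finite computation. The gradient of a
  \<open>P\<^sub>1\<close>-nonconforming function on a square is given by the differences of its values at opposite
  edge midpoints (\<open>NC_affine_on_square\<close>), so \<open>\<nabla>\<Psi>\<^sup>Q\<close> vanishes on squares without a common
  vertex with \<open>Q\<close>. There remain \<open>Q\<close> itself, the squares across an edge of \<open>Q\<close>, whose colour is
  opposite by definition of a checkerboard, and the diagonal neighbours. The latter have the
  colour of \<open>Q\<close>: the vertex shared with \<open>Q\<close> lies in the open domain, hence all four squares
  around it belong to the mesh (\<open>squares_around_interior_vertex\<close>), and a square lying between the
  two is edge-adjacent to both.

  Since \<open>\<psi>\<^sup>V\<close> is specified by its midpoint values through a choice operator, all of this rests on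
  the existence of a function with these values (\<open>NC0_with_midpoint_values\<close>); the choice does not
  matter, as the midpoint values fix the function on the open squares.
\<close>

section \<open>Squares and their edges\<close>

lemma mem_square:
  "x \<in> square h p \<longleftrightarrow> p$1 \<le> x$1 \<and> x$1 \<le> p$1 + h \<and> p$2 \<le> x$2 \<and> x$2 \<le> p$2 + h"
  by (auto simp: square_def mem_box_cart forall_2)

lemma interior_square_eq: "interior (square h p) = box p (p + vector [h, h])"
  by (simp add: square_def)

lemma mem_interior_square:
  "x \<in> interior (square h p) \<longleftrightarrow>
     p$1 < x$1 \<and> x$1 < p$1 + h \<and> p$2 < x$2 \<and> x$2 < p$2 + h"
  by (auto simp: interior_square_eq mem_box_cart forall_2)

lemmas vertex_defs = v_lb_def v_rb_def v_lt_def v_rt_def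

lemma point_eq_iff: "(x :: point) = y \<longleftrightarrow> x$1 = y$1 \<and> x$2 = y$2"
  by (auto simp: vec_eq_iff forall_2)

definition bottom_edge :: "real \<Rightarrow> point \<Rightarrow> point \<times> point" where
  "bottom_edge h p = (v_lb h p, v_rb h p)"
definition top_edge :: "real \<Rightarrow> point \<Rightarrow> point \<times> point" where
  "top_edge h p = (v_lt h p, v_rt h p)"
definition left_edge :: "real \<Rightarrow> point \<Rightarrow> point \<times> point" where
  "left_edge h p = (v_lb h p, v_lt h p)"
definition right_edge :: "real \<Rightarrow> point \<Rightarrow> point \<times> point" where
  "right_edge h p = (v_rb h p, v_rt h p)"

lemmas edge_defs = bottom_edge_def top_edge_def left_edge_def right_edge_def

lemma edges_eq: "edges h p = {bottom_edge h p, top_edge h p, left_edge h p, right_edge h p}"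
  by (simp add: edges_def edge_defs)

definition edge_midpoint :: "point \<times> point \<Rightarrow> point" where
  "edge_midpoint e = midpoint (fst e) (snd e)"

lemma edge_midpoint_components:
  "edge_midpoint (bottom_edge h p) $ 1 = p$1 + h/2" "edge_midpoint (bottom_edge h p) $ 2 = p$2"
  "edge_midpoint (top_edge h p) $ 1 = p$1 + h/2" "edge_midpoint (top_edge h p) $ 2 = p$2 + h"
  "edge_midpoint (left_edge h p) $ 1 = p$1" "edge_midpoint (left_edge h p) $ 2 = p$2 + h/2"
  "edge_midpoint (right_edge h p) $ 1 = p$1 + h" "edge_midpoint (right_edge h p) $ 2 = p$2 + h/2"
  by (simp_all add: edge_midpoint_def edge_defs vertex_defs midpoint_def field_simps)

lemma segment_components:
  fixes a b :: point
  assumes "x \<in> closed_segment a b"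
  obtains t where "0 \<le> t" "t \<le> 1" "x$1 = a$1 + t * (b$1 - a$1)" "x$2 = a$2 + t * (b$2 - a$2)"
proof -
  obtain t where t: "0 \<le> t" "t \<le> 1" "x = (1 - t) *\<^sub>R a + t *\<^sub>R b"
    using assms by (auto simp: closed_segment_def)
  show ?thesis using t(1,2) by (intro that[of t]) (simp_all add: t(3) algebra_simps)
qed

lemma mem_edge:
  assumes "h > 0"
  shows "x \<in> closed_segment (fst (bottom_edge h p)) (snd (bottom_edge h p)) \<Longrightarrow> x$2 = p$2"
    and "x \<in> closed_segment (fst (top_edge h p)) (snd (top_edge h p)) \<Longrightarrow> x$2 = p$2 + h"
    and "x \<in> closed_segment (fst (left_edge h p)) (snd (left_edge h p)) \<Longrightarrow> x$1 = p$1"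
    and "x \<in> closed_segment (fst (right_edge h p)) (snd (right_edge h p)) \<Longrightarrow> x$1 = p$1 + h"
  by (auto elim!: segment_components simp: edge_defs vertex_defs)

lemma edge_disjoint_interior:
  assumes "h > 0" "e \<in> edges h p" "x \<in> closed_segment (fst e) (snd e)"
  shows "x \<notin> interior (square h p)"
  using assms mem_edge[OF assms(1)] by (fastforce simp: edges_eq mem_interior_square)

lemma vertex_not_interior:
  assumes "h > 0" "x \<in> vertices h p" shows "x \<notin> interior (square h p)"
  using assms by (auto simp: vertices_def vertex_defs mem_interior_square)

lemma midpoint_not_vertex:
  assumes "h > 0" "e \<in> edges h p" shows "edge_midpoint e \<notin> vertices h p"
  using assms
  by (auto simp: edges_eq vertices_def point_eq_iff edge_midpoint_components vertex_defs)

lemma midpoint_in_segment: "edge_midpoint e \<in> closed_segment (fst e) (snd e)"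
  by (simp add: edge_midpoint_def)

lemma midpoint_on_edge:
  assumes "h > 0" "e \<in> edges h p" "e' \<in> edges h p"
    and "edge_midpoint e \<in> closed_segment (fst e') (snd e')"
  shows "e = e'"
  using assms mem_edge[OF assms(1), of "edge_midpoint e" p]
  by (auto simp: edges_eq edge_midpoint_components)

lemma midpoint_mem_square:
  assumes "h > 0" "e \<in> edges h p" shows "edge_midpoint e \<in> square h p"
  using assms by (auto simp: edges_eq mem_square edge_midpoint_components)

lemma vertex_on_edge:
  assumes "h > 0" "e \<in> edges h p" "V \<in> vertices h p" "V \<in> closed_segment (fst e) (snd e)"
  shows "V = fst e \<or> V = snd e"
  using assms mem_edge[OF assms(1), of V p]
  by (auto simp: edges_eq vertices_def edge_defs vertex_defs point_eq_iff)

lemma edge_endpoint_vertex: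
  assumes "e \<in> edges h p" shows "fst e \<in> vertices h p" "snd e \<in> vertices h p"
  using assms by (auto simp: edges_def vertices_def)

lemma vertices_subset_square: "h > 0 \<Longrightarrow> vertices h p \<subseteq> square h p"
  by (auto simp: vertices_def vertex_defs mem_square)

section \<open>Conforming meshes\<close>

lemma triangulation_pos: "square_triangulation \<Omega> h T \<Longrightarrow> h > 0"
  and triangulation_finite: "square_triangulation \<Omega> h T \<Longrightarrow> finite T"
  and triangulation_cover: "square_triangulation \<Omega> h T \<Longrightarrow> (\<Union>p\<in>T. square h p) = closure \<Omega>"
  by (simp_all add: square_triangulation_def)

text \<open>
  In this form conformity is applied to a given common point of two squares: to an edge
  midpoint, to a vertex, or to an interior point.
\<close>

lemma triangulation_meet:
  assumes "square_triangulation \<Omega> h T" "p \<in> T" "q \<in> T" "p \<noteq> q"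
    and "x \<in> square h p" "x \<in> square h q"
  obtains (vertex) "x \<in> vertices h p" "x \<in> vertices h q"
    | (edge) e where "e \<in> edges h p" "e \<in> edges h q" "x \<in> closed_segment (fst e) (snd e)"
proof -
  have "square h p \<inter> square h q = {} \<or>
        (\<exists>v \<in> vertices h p \<inter> vertices h q. square h p \<inter> square h q = {v}) \<or>
        (\<exists>(u, w) \<in> edges h p \<inter> edges h q. square h p \<inter> square h q = closed_segment u w)"
    using assms(1-4) unfolding square_triangulation_def by blast
  moreover have x: "x \<in> square h p \<inter> square h q" using assms by blast
  ultimately consider v where "v \<in> vertices h p \<inter> vertices h q" "square h p \<inter> square h q = {v}"
    | e where "e \<in> edges h p \<inter> edges h q" "square h p \<inter> square h q = closed_segment (fst e) (snd e)"
    by fastforce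
  then show ?thesis
  proof cases
    case 1
    then show ?thesis using vertex x by auto
  next
    case 2
    then show ?thesis using edge[of e] x by auto
  qed
qed

lemma interiors_disjoint:
  assumes tri: "square_triangulation \<Omega> h T" and "p \<in> T" "q \<in> T"
    and "x \<in> interior (square h p)" "x \<in> interior (square h q)"
  shows "p = q"
proof (rule ccontr)
  assume "p \<noteq> q"
  have "x \<in> square h p" "x \<in> square h q"
    using assms interior_subset by blast+
  with tri \<open>p \<in> T\<close> \<open>q \<in> T\<close> \<open>p \<noteq> q\<close> show False
    using assms edge_disjoint_interior vertex_not_interior triangulation_pos[OF tri]
    by (cases rule: triangulation_meet) blast+
qed

text \<open>
  By conformity, a square that touches an edge midpoint has the whole edge in common with the
  square that the edge comes from, since the midpoint is not a vertex. Hence edges have distinct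
  midpoints, and continuity at a midpoint concerns only the squares having that edge.
\<close>

lemma edge_of_square_containing_midpoint:
  assumes tri: "square_triangulation \<Omega> h T" and "e \<in> mesh_edges h T" "p \<in> T"
    and mid: "edge_midpoint e \<in> square h p"
  shows "e \<in> edges h p"
proof -
  have h: "h > 0" using tri by (rule triangulation_pos)
  obtain q where q: "q \<in> T" "e \<in> edges h q"
    using assms(2) by (auto simp: mesh_edges_def)
  show ?thesis
  proof (cases "p = q")
    case False
    have "edge_midpoint e \<in> square h q" using midpoint_mem_square[OF h] q by blast
    from tri \<open>p \<in> T\<close> \<open>q \<in> T\<close> False mid this show ?thesis
    proof (cases rule: triangulation_meet)
      case vertex
      then show ?thesis using midpoint_not_vertex[OF h q(2)] by blast
    next
      case (edge e')
      then show ?thesis using midpoint_on_edge[OF h q(2)] by blast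
    qed
  qed (use q in simp)
qed

lemma edge_midpoint_inj:
  assumes tri: "square_triangulation \<Omega> h T" and "e \<in> mesh_edges h T" "e' \<in> mesh_edges h T"
    and eq: "edge_midpoint e = edge_midpoint e'"
  shows "e = e'"
proof -
  have h: "h > 0" using tri by (rule triangulation_pos)
  obtain q where q: "q \<in> T" "e \<in> edges h q" using assms(2) by (auto simp: mesh_edges_def)
  have "e' \<in> edges h q"
    using edge_of_square_containing_midpoint[OF tri assms(3) q(1)] midpoint_mem_square[OF h q(2)] eq
    by simp
  then show ?thesis using midpoint_on_edge[OF h q(2)] midpoint_in_segment[of e'] eq by simp
qed

lemma midpoint_not_interior:
  assumes tri: "square_triangulation \<Omega> h T" and "e \<in> mesh_edges h T" "p \<in> T"
  shows "edge_midpoint e \<notin> interior (square h p)"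
  using edge_of_square_containing_midpoint[OF assms] edge_disjoint_interior midpoint_in_segment
    triangulation_pos[OF tri] interior_subset by blast

lemma finite_mesh_edges: "finite T \<Longrightarrow> finite (mesh_edges h T)"
  by (simp add: mesh_edges_def edges_def)

text \<open>
  A vertex \<open>V\<close> off the boundary lies in the open set \<open>\<Omega>\<close>, so each of the four quadrants at \<open>V\<close>,
  selected by the signs \<open>a\<close> and \<open>b\<close>, contains points of \<open>\<Omega>\<close> close to \<open>V\<close>. A square covering such
  a point also contains \<open>V\<close>, because the finitely many squares avoiding \<open>V\<close> stay away from it.
  Conformity with \<open>Q\<close> makes \<open>V\<close> a vertex of that square, which leaves one position for it.
\<close>

lemma squares_around_interior_vertex:
  assumes tri: "square_triangulation \<Omega> h T" and "open \<Omega>" and Q: "Q \<in> T"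
    and V: "V \<in> vertices h Q" "V \<notin> frontier \<Omega>"
    and ab: "a \<in> {1, -1}" "b \<in> {1, -1}"
  shows "V + vector [(a - 1) / 2 * h, (b - 1) / 2 * h] \<in> T"
proof -
  have h: "h > 0" using tri by (rule triangulation_pos)
  have VQ: "V \<in> square h Q" using vertices_subset_square[OF h] V by blast
  then have "V \<in> closure \<Omega>" using triangulation_cover[OF tri] Q by blast
  with V(2) \<open>open \<Omega>\<close> have "V \<in> \<Omega>" by (simp add: frontier_def interior_open)
  \<comment> \<open>A neighbourhood of \<open>V\<close> that meets only squares containing \<open>V\<close>.\<close>
  define U where "U = \<Omega> - (\<Union>q\<in>{q\<in>T. V \<notin> square h q}. square h q)"
  have "open U" unfolding U_def
    using \<open>open \<Omega>\<close> triangulation_finite[OF tri] by (intro open_Diff closed_UN) (auto simp: square_def)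
  moreover have "V \<in> U" using \<open>V \<in> \<Omega>\<close> by (auto simp: U_def)
  moreover have "((\<lambda>t. V + t *\<^sub>R vector [a, b]) \<longlongrightarrow> V + 0 *\<^sub>R vector [a, b]) (at_right (0::real))"
    by (intro tendsto_intros)
  ultimately have "\<forall>\<^sub>F t in at_right (0::real). V + t *\<^sub>R vector [a, b] \<in> U"
    by (intro topological_tendstoD[where l = V]) auto
  then obtain s where s: "s > 0" "\<And>t. 0 < t \<Longrightarrow> t < s \<Longrightarrow> V + t *\<^sub>R vector [a, b] \<in> U"
    by (auto simp: eventually_at_right_field)
  \<comment> \<open>With \<open>t < h\<close> the point determines which of the four squares with vertex \<open>V\<close> covers it.\<close>
  define t where "t = min s h / 2"
  have t: "0 < t" "t < s" "t < h" using s(1) h by (auto simp: t_def)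
  let ?z = "V + t *\<^sub>R vector [a, b] :: point"
  have zU: "?z \<in> U" using s t by blast
  then have "?z \<in> closure \<Omega>" using closure_subset by (auto simp: U_def)
  then obtain q where q: "q \<in> T" "?z \<in> square h q" using triangulation_cover[OF tri] by blast
  with zU have Vq: "V \<in> square h q" by (auto simp: U_def)
  have "V \<in> vertices h q"
  proof (cases "q = Q")
    case False
    from tri \<open>q \<in> T\<close> Q False Vq VQ show ?thesis
    proof (cases rule: triangulation_meet)
      case (edge e)
      then show ?thesis using vertex_on_edge[OF h edge(2) V(1)] edge_endpoint_vertex[OF edge(1)] by auto
    qed
  qed (use V in simp)
  with q(2) t ab have "q = V + vector [(a - 1) / 2 * h, (b - 1) / 2 * h]"
    by (auto simp: vertices_def vertex_defs mem_square point_eq_iff)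
  with q show ?thesis by simp
qed

section \<open>Functions with prescribed edge-midpoint values\<close>

text \<open>
  The affine function through the edge-midpoint values of \<open>g\<close>, expanded about the centre of the
  square. Its value there is the mean of the left and right values; that the bottom and top
  values are attained as well is the compatibility condition on \<open>g\<close>.
\<close>

definition midpoint_interpolant :: "real \<Rightarrow> (point \<times> point \<Rightarrow> real) \<Rightarrow> point \<Rightarrow> point \<Rightarrow> real" where
  "midpoint_interpolant h g p x =
     (g (left_edge h p) + g (right_edge h p)) / 2
     + (g (right_edge h p) - g (left_edge h p)) / h * (x$1 - p$1 - h/2)
     + (g (top_edge h p) - g (bottom_edge h p)) / h * (x$2 - p$2 - h/2)"

lemma midpoint_interpolant_at_midpoint:
  assumes "h > 0" "e \<in> edges h p"
    and "g (left_edge h p) + g (right_edge h p) = g (bottom_edge h p) + g (top_edge h p)"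
  shows "midpoint_interpolant h g p (edge_midpoint e) = g e"
proof -
  have "g (right_edge h p) = g (bottom_edge h p) + g (top_edge h p) - g (left_edge h p)"
    using assms(3) by simp
  then show ?thesis
    using assms(1,2)
    by (auto simp: edges_eq midpoint_interpolant_def edge_midpoint_components divide_simps)
       (simp_all add: algebra_simps)
qed

lemma continuous_on_midpoint_interpolant: "continuous_on S (midpoint_interpolant h g p)"
  unfolding midpoint_interpolant_def by (intro continuous_intros)

lemma integrable_square_of_bounded_borel:
  fixes v :: "point \<Rightarrow> real"
  assumes "open \<Omega>" "bounded \<Omega>" and meas: "v \<in> borel_measurable borel" and B: "\<And>x. \<bar>v x\<bar> \<le> B"
  shows "v \<in> borel_measurable (lebesgue_on \<Omega>)" "integrable (lebesgue_on \<Omega>) (\<lambda>x. (v x)\<^sup>2)"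
proof -
  show m: "v \<in> borel_measurable (lebesgue_on \<Omega>)"
    using meas by (intro measurable_restrict_space1 measurable_completion) simp
  have "\<Omega> \<in> lmeasurable" using assms by (simp add: lmeasurable_open)
  then interpret finite_measure "lebesgue_on \<Omega>" by (rule finite_measure_lebesgue_on)
  have "norm ((v x)\<^sup>2) \<le> B\<^sup>2" for x using B[of x] abs_le_square_iff[of "v x" B] by auto
  then show "integrable (lebesgue_on \<Omega>) (\<lambda>x. (v x)\<^sup>2)"
    using m by (intro integrable_const_bound[where B = "B\<^sup>2"]) auto
qed

text \<open>
  The interpolants of the single open squares are glued, and the values of \<open>g\<close> are put at the
  midpoints. As sums of indicator terms, the result is visibly bounded and Borel measurable, hence
  square integrable. It is continuous at a midpoint because every square near it has
  the corresponding edge, so that its interpolant tends to the same value of \<open>g\<close>.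
\<close>

lemma NC0_with_midpoint_values:
  assumes "open \<Omega>" "bounded \<Omega>" and tri: "square_triangulation \<Omega> h T"
    and balanced: "\<And>p. p \<in> T \<Longrightarrow>
      g (left_edge h p) + g (right_edge h p) = g (bottom_edge h p) + g (top_edge h p)"
    and bdry: "\<And>e. e \<in> mesh_edges h T \<Longrightarrow> boundary_edge \<Omega> e \<Longrightarrow> g e = 0"
  shows "\<exists>v\<in>NC0 \<Omega> h T. \<forall>e\<in>mesh_edges h T. v (edge_midpoint e) = g e"
proof -
  have h: "h > 0" and fin: "finite T" and finE: "finite (mesh_edges h T)"
    using tri by (simp_all add: triangulation_pos triangulation_finite finite_mesh_edges)
  define I where "I p = interior (square h p)" for p
  define piece where "piece p x = indicator (I p) x * midpoint_interpolant h g p x" for p x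
  define v where "v x = (\<Sum>p\<in>T. piece p x) + (\<Sum>e\<in>mesh_edges h T. indicator {edge_midpoint e} x * g e)" for x
  have v_mid: "v (edge_midpoint e) = g e" if e: "e \<in> mesh_edges h T" for e
  proof -
    have "(\<Sum>p\<in>T. piece p (edge_midpoint e)) = 0"
      using midpoint_not_interior[OF tri e] by (intro sum.neutral) (simp add: piece_def I_def)
    moreover have "(\<Sum>e'\<in>mesh_edges h T. indicator {edge_midpoint e'} (edge_midpoint e) * g e')
        = (\<Sum>e'\<in>mesh_edges h T. if e' = e then g e else 0)"
      using edge_midpoint_inj[OF tri e] by (intro sum.cong) (auto simp: indicator_def)
    ultimately show ?thesis using finE e by (simp add: v_def sum.delta)
  qed
  have v_int: "v x = midpoint_interpolant h g p x" if p: "p \<in> T" and x: "x \<in> I p" for p x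
  proof -
    have "(\<Sum>e\<in>mesh_edges h T. indicator {edge_midpoint e} x * g e) = 0"
      using midpoint_not_interior[OF tri _ p] x by (intro sum.neutral) (auto simp: indicator_def I_def)
    moreover have "(\<Sum>q\<in>T. piece q x) = (\<Sum>q\<in>T. if q = p then midpoint_interpolant h g p x else 0)"
      using interiors_disjoint[OF tri p] x
      by (intro sum.cong) (auto simp: piece_def indicator_def I_def)
    ultimately show ?thesis using fin p by (simp add: v_def sum.delta)
  qed
  have "\<forall>p. \<exists>B. \<forall>x. \<bar>piece p x\<bar> \<le> B"
  proof
    fix p
    have "bounded (midpoint_interpolant h g p ` square h p)"
      by (intro compact_imp_bounded compact_continuous_image continuous_on_midpoint_interpolant)
         (simp add: square_def)
    then obtain B where B: "B > 0" "\<And>x. x \<in> square h p \<Longrightarrow> \<bar>midpoint_interpolant h g p x\<bar> \<le> B"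
      by (auto simp: bounded_pos)
    then have "\<bar>piece p x\<bar> \<le> B" for x
      using interior_subset[of "square h p"] by (auto simp: piece_def I_def indicator_def)
    then show "\<exists>B. \<forall>x. \<bar>piece p x\<bar> \<le> B" by blast
  qed
  then obtain B where B: "\<And>p x. \<bar>piece p x\<bar> \<le> B p" by metis
  have "\<bar>v x\<bar> \<le> (\<Sum>p\<in>T. B p) + (\<Sum>e\<in>mesh_edges h T. \<bar>g e\<bar>)" for x
  proof -
    have "\<bar>\<Sum>p\<in>T. piece p x\<bar> \<le> (\<Sum>p\<in>T. B p)"
      by (rule order_trans[OF sum_abs]) (intro sum_mono B)
    moreover have "\<bar>\<Sum>e\<in>mesh_edges h T. indicator {edge_midpoint e} x * g e\<bar>
        \<le> (\<Sum>e\<in>mesh_edges h T. \<bar>g e\<bar>)"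
      by (rule order_trans[OF sum_abs]) (intro sum_mono, auto simp: indicator_def)
    ultimately show ?thesis unfolding v_def by linarith
  qed
  moreover have "v \<in> borel_measurable borel"
  proof -
    have "midpoint_interpolant h g p \<in> borel_measurable borel" for p
      by (intro borel_measurable_continuous_onI continuous_on_midpoint_interpolant)
    then show ?thesis unfolding v_def piece_def I_def
      by (intro borel_measurable_add borel_measurable_sum borel_measurable_times
            borel_measurable_indicator borel_measurable_const) auto
  qed
  ultimately have L2: "v \<in> borel_measurable (lebesgue_on \<Omega>)" "integrable (lebesgue_on \<Omega>) (\<lambda>x. (v x)\<^sup>2)"
    using integrable_square_of_bounded_borel[OF assms(1,2)] by blast+
  have affine: "\<exists>a b c. \<forall>x\<in>interior (square h p). v x = a + b * x$1 + c * x$2" if p: "p \<in> T" for p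
  proof -
    let ?b = "(g (right_edge h p) - g (left_edge h p)) / h"
    let ?c = "(g (top_edge h p) - g (bottom_edge h p)) / h"
    have "\<forall>x\<in>interior (square h p). v x = ((g (left_edge h p) + g (right_edge h p)) / 2
        - ?b * (p$1 + h/2) - ?c * (p$2 + h/2)) + ?b * x$1 + ?c * x$2"
      using v_int[OF p] by (simp add: I_def midpoint_interpolant_def algebra_simps)
    then show ?thesis by blast
  qed
  have cont: "continuous (at m within insert m (\<Union>p\<in>T. I p)) v"
    if e: "e \<in> mesh_edges h T" and m: "m = edge_midpoint e" for e m
    unfolding continuous_within
  proof (rule tendstoI)
    fix \<epsilon> :: real assume "\<epsilon> > 0"
    let ?F = "at m within insert m (\<Union>p\<in>T. I p)"
    have "\<forall>\<^sub>F x in ?F. x \<in> I p \<longrightarrow> dist (v x) (v m) < \<epsilon>" if p: "p \<in> T" for p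
    proof (cases "m \<in> square h p")
      case True
      then have "e \<in> edges h p"
        using edge_of_square_containing_midpoint[OF tri e p] m by simp
      then have eq: "midpoint_interpolant h g p m = v m"
        using midpoint_interpolant_at_midpoint[OF h] balanced[OF p] v_mid[OF e] m by simp
      have "(midpoint_interpolant h g p \<longlongrightarrow> midpoint_interpolant h g p m) ?F"
        using continuous_on_midpoint_interpolant[of UNIV h g p]
        by (metis continuous_on_def UNIV_I tendsto_within_subset subset_UNIV)
      then have "\<forall>\<^sub>F x in ?F. dist (midpoint_interpolant h g p x) (v m) < \<epsilon>"
        using \<open>\<epsilon> > 0\<close> unfolding eq by (rule tendstoD)
      then show ?thesis by eventually_elim (simp add: v_int[OF p])
    next
      case False
      have "\<forall>\<^sub>F x in ?F. x \<in> - square h p"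
        using False
        by (intro topological_tendstoD[OF tendsto_ident_at]) (auto simp: square_def closed_open[symmetric])
      then show ?thesis
        by eventually_elim (use interior_subset in \<open>auto simp: I_def\<close>)
    qed
    then have "\<forall>\<^sub>F x in ?F. \<forall>p\<in>T. x \<in> I p \<longrightarrow> dist (v x) (v m) < \<epsilon>"
      using fin by (intro eventually_ball_finite) blast+
    moreover have "\<forall>\<^sub>F x in ?F. x \<in> insert m (\<Union>p\<in>T. I p)"
      by (simp add: eventually_at_filter)
    ultimately show "\<forall>\<^sub>F x in ?F. dist (v x) (v m) < \<epsilon>"
      by eventually_elim (use \<open>\<epsilon> > 0\<close> in auto)
  qed
  have "v \<in> NC0 \<Omega> h T"
    using L2 affine cont bdry v_mid
    by (fastforce simp: NC0_def NC_def I_def edge_midpoint_def)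
  with v_mid show ?thesis by blast
qed

text \<open>
  Each vertex of a square is an endpoint of exactly one of every two opposite edges, so the values
  required of \<open>\<psi>\<^sup>V\<close> satisfy the compatibility condition. They vanish on boundary edges because such
  an edge has its endpoints on the boundary while \<open>V\<close> is not.
\<close>

lemma psi_spec:
  assumes "open \<Omega>" "bounded \<Omega>" and tri: "square_triangulation \<Omega> h T" and V: "V \<notin> frontier \<Omega>"
  shows "psi \<Omega> h T V c \<in> NC0_vec \<Omega> h T"
    and "e \<in> mesh_edges h T \<Longrightarrow>
      psi \<Omega> h T V c (edge_midpoint e) = (if V = fst e \<or> V = snd e then c else 0)"
proof -
  have h: "h > 0" using tri by (rule triangulation_pos)
  define g where "g i e = (if V = fst e \<or> V = snd e then c $ i else 0)" for i and e :: "point \<times> point"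
  have bal: "g i (left_edge h p) + g i (right_edge h p) = g i (bottom_edge h p) + g i (top_edge h p)" for i p
    using h by (auto simp: g_def edge_defs vertex_defs point_eq_iff)
  have "g i e = 0" if "boundary_edge \<Omega> e" for i e
    using that V by (auto simp: boundary_edge_def g_def)
  with bal have "\<forall>i. \<exists>v\<in>NC0 \<Omega> h T. \<forall>e\<in>mesh_edges h T. v (edge_midpoint e) = g i e"
    by (intro allI NC0_with_midpoint_values assms) auto
  then obtain w where w: "\<And>i. w i \<in> NC0 \<Omega> h T"
    "\<And>i e. e \<in> mesh_edges h T \<Longrightarrow> w i (edge_midpoint e) = g i e" by metis
  have "\<exists>v. v \<in> NC0_vec \<Omega> h T \<and>
     (\<forall>(u, w)\<in>mesh_edges h T. v (midpoint u w) = (if V = u \<or> V = w then c else 0))"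
    using w by (intro exI[of _ "\<lambda>x. \<chi> i. w i x"])
      (fastforce simp: NC0_vec_def vec_eq_iff g_def edge_midpoint_def)
  then have *: "psi \<Omega> h T V c \<in> NC0_vec \<Omega> h T \<and>
     (\<forall>(u, w)\<in>mesh_edges h T. psi \<Omega> h T V c (midpoint u w) = (if V = u \<or> V = w then c else 0))"
    unfolding psi_def by (rule someI_ex)
  then show "psi \<Omega> h T V c \<in> NC0_vec \<Omega> h T" by (rule conjunct1)
  show "psi \<Omega> h T V c (edge_midpoint e) = (if V = fst e \<or> V = snd e then c else 0)"
    if "e \<in> mesh_edges h T"
    using bspec[OF conjunct2[OF *] that] by (simp add: edge_midpoint_def case_prod_beta)
qed

section \<open>Elementwise gradients from midpoint values\<close>

text \<open>
  Continuity at a midpoint, approached from inside one square, forces the affine function of that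
  square to take the midpoint value in the limit. Differences of opposite midpoint values then
  give its two slopes, whatever representative was chosen.
\<close>

lemma NC_affine_on_square:
  assumes v: "v \<in> NC \<Omega> h T" and "h > 0" and p: "p \<in> T"
  shows "\<exists>a. \<forall>x\<in>interior (square h p). v x = a
     + (v (edge_midpoint (right_edge h p)) - v (edge_midpoint (left_edge h p))) / h * x$1
     + (v (edge_midpoint (top_edge h p)) - v (edge_midpoint (bottom_edge h p))) / h * x$2"
proof -
  obtain a b c where abc: "\<And>x. x \<in> interior (square h p) \<Longrightarrow> v x = a + b * x$1 + c * x$2"
    using v p unfolding NC_def by blast
  have mid: "v m = a + b * m$1 + c * m$2" if e: "e \<in> edges h p" and m: "m = edge_midpoint e" for e m
  proof -
    let ?I = "interior (square h p)"
    have "continuous (at m within insert m (\<Union>p\<in>T. interior (square h p))) v"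
      using v e m p by (fastforce simp: NC_def mesh_edges_def edge_midpoint_def)
    then have "(v \<longlongrightarrow> v m) (at m within ?I)"
      unfolding continuous_within by (rule tendsto_within_subset) (use p in auto)
    moreover have "\<forall>\<^sub>F x in at m within ?I. v x = a + b * x$1 + c * x$2"
      using abc by (simp add: eventually_at_filter)
    ultimately have 1: "((\<lambda>x. a + b * x$1 + c * x$2) \<longlongrightarrow> v m) (at m within ?I)"
      by (rule Lim_transform_eventually)
    have "m \<notin> ?I"
      using edge_disjoint_interior[OF \<open>h > 0\<close> e] midpoint_in_segment m by blast
    moreover have "m \<in> closure ?I"
    proof -
      have "p + vector [h/2, h/2] \<in> box p (p + vector [h, h])"
        using \<open>h > 0\<close> by (simp add: mem_box_cart forall_2)
      then have "closure ?I = square h p"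
        unfolding interior_square_eq unfolding square_def by (intro closure_box) blast
      then show ?thesis using midpoint_mem_square[OF \<open>h > 0\<close> e] m by simp
    qed
    ultimately have "at m within ?I \<noteq> bot"
      using trivial_limit_within by (auto simp: closure_def)
    then show ?thesis
      by (rule tendsto_unique[OF _ 1]) (intro tendsto_intros)
  qed
  have "v (edge_midpoint (right_edge h p)) - v (edge_midpoint (left_edge h p)) = b * h"
    and "v (edge_midpoint (top_edge h p)) - v (edge_midpoint (bottom_edge h p)) = c * h"
    by (simp_all add: mid[OF _ refl] edges_eq edge_midpoint_components algebra_simps)
  then show ?thesis using abc \<open>h > 0\<close> by auto
qed

lemma NC0_vec_affine_on_square:
  assumes v: "v \<in> NC0_vec \<Omega> h T" and "h > 0" and p: "p \<in> T"
  shows "\<exists>a. \<forall>x\<in>interior (square h p). v x = a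
     + (x$1 / h) *\<^sub>R (v (edge_midpoint (right_edge h p)) - v (edge_midpoint (left_edge h p)))
     + (x$2 / h) *\<^sub>R (v (edge_midpoint (top_edge h p)) - v (edge_midpoint (bottom_edge h p)))"
proof -
  have "\<forall>i. (\<lambda>x. v x $ i) \<in> NC \<Omega> h T" using v by (auto simp: NC0_vec_def NC0_def)
  then have "\<forall>i. \<exists>a. \<forall>x\<in>interior (square h p). v x $ i = a
     + (v (edge_midpoint (right_edge h p)) $ i - v (edge_midpoint (left_edge h p)) $ i) / h * x$1
     + (v (edge_midpoint (top_edge h p)) $ i - v (edge_midpoint (bottom_edge h p)) $ i) / h * x$2"
    using NC_affine_on_square[OF _ \<open>h > 0\<close> p] by blast
  then obtain a where "\<And>i x. x \<in> interior (square h p) \<Longrightarrow> v x $ i = a i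
     + (v (edge_midpoint (right_edge h p)) $ i - v (edge_midpoint (left_edge h p)) $ i) / h * x$1
     + (v (edge_midpoint (top_edge h p)) $ i - v (edge_midpoint (bottom_edge h p)) $ i) / h * x$2"
    by metis
  then show ?thesis
    by (intro exI[of _ "\<chi> i. a i"]) (simp add: vec_eq_iff mult.commute)
qed

lemma jacobian_affine:
  fixes v :: "point \<Rightarrow> real^2"
  assumes "open S" "x \<in> S" "\<And>y. y \<in> S \<Longrightarrow> v y = a + y$1 *\<^sub>R b + y$2 *\<^sub>R c"
  shows "jacobian v (at x) $ i = vector [b $ i, c $ i]"
proof -
  let ?L = "\<lambda>y::point. y$1 *\<^sub>R b + y$2 *\<^sub>R c"
  have nth: "((\<lambda>y::point. y $ j) has_derivative (\<lambda>y. y $ j)) (at x)" for j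
    by (rule bounded_linear_imp_has_derivative[OF bounded_linear_vec_nth])
  have "((\<lambda>y. a + y$1 *\<^sub>R b + y$2 *\<^sub>R c) has_derivative ?L) (at x)"
    by (auto intro!: derivative_eq_intros nth)
  then have "(v has_derivative ?L) (at x)"
    by (rule has_derivative_transform_within_open[OF _ assms(1,2)]) (simp add: assms(3))
  then have "frechet_derivative v (at x) = ?L" by (simp add: frechet_derivative_at[symmetric])
  then show ?thesis
    by (simp add: jacobian_def matrix_def point_eq_iff axis_def)
qed

text \<open>
  The differences right minus left and top minus bottom, over the square \<open>p\<close>, of the midpoint
  values of the scalar nodal function of \<open>V\<close>.
\<close>

definition hat_dx :: "real \<Rightarrow> point \<Rightarrow> point \<Rightarrow> real" where
  "hat_dx h V p = of_bool (V \<in> {v_rb h p, v_rt h p}) - of_bool (V \<in> {v_lb h p, v_lt h p})"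

definition hat_dy :: "real \<Rightarrow> point \<Rightarrow> point \<Rightarrow> real" where
  "hat_dy h V p = of_bool (V \<in> {v_lt h p, v_rt h p}) - of_bool (V \<in> {v_lb h p, v_rb h p})"

lemma psi_affine_on_square:
  assumes "open \<Omega>" "bounded \<Omega>" and tri: "square_triangulation \<Omega> h T"
    and V: "V \<notin> frontier \<Omega>" and p: "p \<in> T"
  shows "\<exists>a. \<forall>x\<in>interior (square h p). psi \<Omega> h T V c x =
    a + x$1 *\<^sub>R (hat_dx h V p / h) *\<^sub>R c + x$2 *\<^sub>R (hat_dy h V p / h) *\<^sub>R c"
proof -
  note spec = psi_spec[OF assms(1-4), where c = c]
  have "psi \<Omega> h T V c (edge_midpoint (right_edge h p)) - psi \<Omega> h T V c (edge_midpoint (left_edge h p))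
      = hat_dx h V p *\<^sub>R c"
    and "psi \<Omega> h T V c (edge_midpoint (top_edge h p)) - psi \<Omega> h T V c (edge_midpoint (bottom_edge h p))
      = hat_dy h V p *\<^sub>R c"
    using p by (subst (1 2) spec(2);
      auto simp: mesh_edges_def edges_eq edge_defs hat_dx_def hat_dy_def)+
  with NC0_vec_affine_on_square[OF spec(1) triangulation_pos[OF tri] p] show ?thesis
    by (simp add: divide_inverse mult_ac)
qed

text \<open>
  The columns of the Jacobian of \<open>\<Psi>\<^sup>Q\<close> on the square \<open>p\<close>, scaled by \<open>h\<close>.
\<close>

definition Psi_dx :: "real \<Rightarrow> point \<Rightarrow> point \<Rightarrow> real^2" where
  "Psi_dx h Q p = hat_dx h (v_rt h Q) p *\<^sub>R vector [1/2, -1/2] + hat_dx h (v_lt h Q) p *\<^sub>R vector [1/2, 1/2]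
     + hat_dx h (v_lb h Q) p *\<^sub>R vector [-1/2, 1/2] + hat_dx h (v_rb h Q) p *\<^sub>R vector [-1/2, -1/2]"

definition Psi_dy :: "real \<Rightarrow> point \<Rightarrow> point \<Rightarrow> real^2" where
  "Psi_dy h Q p = hat_dy h (v_rt h Q) p *\<^sub>R vector [1/2, -1/2] + hat_dy h (v_lt h Q) p *\<^sub>R vector [1/2, 1/2]
     + hat_dy h (v_lb h Q) p *\<^sub>R vector [-1/2, 1/2] + hat_dy h (v_rb h Q) p *\<^sub>R vector [-1/2, -1/2]"

lemma Psi_jacobian:
  assumes "open \<Omega>" "bounded \<Omega>" and tri: "square_triangulation \<Omega> h T"
    and Q: "interior_square \<Omega> h T Q" and p: "p \<in> T" and x: "x \<in> interior (square h p)"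
  shows "jacobian (Psi \<Omega> h T Q) (at x) $ i = vector [Psi_dx h Q p $ i / h, Psi_dy h Q p $ i / h]"
proof -
  have fr: "V \<notin> frontier \<Omega>" if "V \<in> vertices h Q" for V
    using that Q by (auto simp: interior_square_def boundary_vertices_def)
  note aff = psi_affine_on_square[OF assms(1,2) tri fr p]
  have V: "v_rt h Q \<in> vertices h Q" "v_lt h Q \<in> vertices h Q"
    "v_lb h Q \<in> vertices h Q" "v_rb h Q \<in> vertices h Q" by (auto simp: vertices_def)
  obtain a1 a2 a3 a4 where a: "\<And>y. y \<in> interior (square h p) \<Longrightarrow> Psi \<Omega> h T Q y =
      (a1 + y$1 *\<^sub>R (hat_dx h (v_rt h Q) p / h) *\<^sub>R vector [1/2, -1/2] + y$2 *\<^sub>R (hat_dy h (v_rt h Q) p / h) *\<^sub>R vector [1/2, -1/2])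
    + (a2 + y$1 *\<^sub>R (hat_dx h (v_lt h Q) p / h) *\<^sub>R vector [1/2, 1/2] + y$2 *\<^sub>R (hat_dy h (v_lt h Q) p / h) *\<^sub>R vector [1/2, 1/2])
    + (a3 + y$1 *\<^sub>R (hat_dx h (v_lb h Q) p / h) *\<^sub>R vector [-1/2, 1/2] + y$2 *\<^sub>R (hat_dy h (v_lb h Q) p / h) *\<^sub>R vector [-1/2, 1/2])
    + (a4 + y$1 *\<^sub>R (hat_dx h (v_rb h Q) p / h) *\<^sub>R vector [-1/2, -1/2] + y$2 *\<^sub>R (hat_dy h (v_rb h Q) p / h) *\<^sub>R vector [-1/2, -1/2])"
    using aff[OF V(1), of "vector [1/2, -1/2]"] aff[OF V(2), of "vector [1/2, 1/2]"]
      aff[OF V(3), of "vector [-1/2, 1/2]"] aff[OF V(4), of "vector [-1/2, -1/2]"]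
    unfolding Psi_def by metis
  have "jacobian (Psi \<Omega> h T Q) (at x) $ i
      = vector [((1/h) *\<^sub>R Psi_dx h Q p) $ i, ((1/h) *\<^sub>R Psi_dy h Q p) $ i]"
    using x by (intro jacobian_affine[of "interior (square h p)" _ _ "a1 + a2 + a3 + a4"])
      (auto simp: a Psi_dx_def Psi_dy_def point_eq_iff field_simps)
  then show ?thesis by simp
qed

section \<open>Colours and the shape of the gradient\<close>

lemma hat_eq_0:
  assumes "V \<notin> vertices h p" shows "hat_dx h V p = 0" "hat_dy h V p = 0"
  using assms by (auto simp: hat_dx_def hat_dy_def vertices_def)

lemma vertices_as_offsets:
  "v_rt h Q = Q + vector [h, h]" "v_lt h Q = Q + vector [0, h]"
  "v_lb h Q = Q + vector [0, 0]" "v_rb h Q = Q + vector [h, 0]"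
  by (simp_all add: vertex_defs point_eq_iff)

text \<open>
  The gradient of a nodal function depends only on the relative position of the vertex and the
  square; this turns the claims below into the evaluation of a few numerical conditions.
\<close>

lemma hat_of_offsets:
  assumes "h > 0"
  shows "hat_dx h (Q + vector [i, j]) (Q + vector [k, l])
      = (of_bool (i = k + h) - of_bool (i = k)) * of_bool (j = l \<or> j = l + h)"
    and "hat_dy h (Q + vector [i, j]) (Q + vector [k, l])
      = (of_bool (j = l + h) - of_bool (j = l)) * of_bool (i = k \<or> i = k + h)"
  using assms
  by (simp_all add: hat_dx_def hat_dy_def vertex_defs point_eq_iff of_bool_def add.assoc)

lemma Psi_gradient_diagonal:
  assumes "h > 0" and "s = 0 \<and> t = 0 \<or> s \<in> {h, -h} \<and> t \<in> {h, -h}" and "p = Q + vector [s, t]"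
  shows "Psi_dx h Q p $ 2 + Psi_dy h Q p $ 1 = 0"
proof -
  consider "s = 0 \<and> t = 0" | "s = h \<and> t = h" | "s = h \<and> t = -h" | "s = -h \<and> t = h" | "s = -h \<and> t = -h"
    using assms(2) by auto
  then show ?thesis
    by cases (use \<open>h > 0\<close> in \<open>simp_all add: assms(3) Psi_dx_def Psi_dy_def vertices_as_offsets hat_of_offsets\<close>)
qed

lemma Psi_gradient_adjacent:
  assumes "h > 0" and "s \<in> {h, -h}" and "p = Q + vector [s, 0] \<or> p = Q + vector [0, s]"
  shows "Psi_dx h Q p $ 1 = 0 \<and> Psi_dy h Q p $ 2 = 0 \<and> Psi_dx h Q p $ 2 = Psi_dy h Q p $ 1"
proof -
  consider "p = Q + vector [h, 0]" | "p = Q + vector [-h, 0]" | "p = Q + vector [0, h]" | "p = Q + vector [0, -h]"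
    using assms(2,3) by auto
  then show ?thesis
    by cases (use \<open>h > 0\<close> in \<open>simp_all add: Psi_dx_def Psi_dy_def vertices_as_offsets hat_of_offsets\<close>)
qed

lemma checkerboard_adjacent:
  assumes "checkerboard h T Red Black" "p \<in> T" "q \<in> T" "h > 0"
    and "s \<in> {h, -h}" "q = p + vector [s, 0] \<or> q = p + vector [0, s]"
  shows "p \<in> Red \<longleftrightarrow> q \<notin> Red"
proof -
  have "p \<noteq> q" using assms by (auto simp: point_eq_iff)
  moreover have "edges h p \<inter> edges h q \<noteq> {}"
    using assms(4-) by (auto simp: edges_def vertex_defs point_eq_iff)
  ultimately show ?thesis using assms(1-3) unfolding checkerboard_def by blast
qed

text \<open>
  The squares share a single vertex, which is not on the boundary. Hence the square between them
  belongs to the mesh, and the colour changes twice on the way.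
\<close>

lemma diagonal_same_colour:
  assumes chk: "checkerboard h T Red Black" and tri: "square_triangulation \<Omega> h T" and "open \<Omega>"
    and Q: "interior_square \<Omega> h T Q" and p: "p \<in> T"
    and st: "s \<in> {h, -h}" "t \<in> {h, -h}" "p = Q + vector [s, t]"
  shows "p \<in> Red \<longleftrightarrow> Q \<in> Red"
proof -
  have h: "h > 0" using tri by (rule triangulation_pos)
  \<comment> \<open>The shared vertex, and the square reached from \<open>Q\<close> by the horizontal step alone.\<close>
  let ?V = "Q + vector [(h + s) / 2, (h + t) / 2] :: point"
  let ?M = "Q + vector [s, 0] :: point"
  have QT: "Q \<in> T" using Q by (simp add: interior_square_def)
  have V: "?V \<in> vertices h Q"
    using st by (auto simp: vertices_def vertex_defs point_eq_iff)
  then have "?V \<notin> frontier \<Omega>" using Q by (auto simp: interior_square_def boundary_vertices_def)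
  from squares_around_interior_vertex[OF tri \<open>open \<Omega>\<close> QT V this, of "s/h" "-t/h"]
  have "?V + vector [(s/h - 1) / 2 * h, (- t/h - 1) / 2 * h] \<in> T" using st h by auto
  also have "?V + vector [(s/h - 1) / 2 * h, (- t/h - 1) / 2 * h] = ?M"
    using h by (simp add: point_eq_iff field_simps)
  finally have M: "?M \<in> T" .
  have "p = ?M + vector [0, t]" using st by (simp add: point_eq_iff)
  then show ?thesis
    using checkerboard_adjacent[OF chk QT M h st(1)] checkerboard_adjacent[OF chk M p h st(2)] by blast
qed

text \<open>
  On squares having no vertex in common with \<open>Q\<close> the gradient is zero, which has both shapes.
  On the others the position relative to \<open>Q\<close> settles both the colour
  and the shape.
\<close>

lemma Psi_gradient_by_colour:
  assumes chk: "checkerboard h T Red Black" and tri: "square_triangulation \<Omega> h T" and "open \<Omega>"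
    and Q: "interior_square \<Omega> h T Q" and p: "p \<in> T"
  shows "(p \<in> Red \<longleftrightarrow> Q \<in> Red) \<Longrightarrow> Psi_dx h Q p $ 2 + Psi_dy h Q p $ 1 = 0"
    and "(p \<in> Red \<longleftrightarrow> Q \<notin> Red) \<Longrightarrow>
      Psi_dx h Q p $ 1 = 0 \<and> Psi_dy h Q p $ 2 = 0 \<and> Psi_dx h Q p $ 2 = Psi_dy h Q p $ 1"
proof -
  have h: "h > 0" using tri by (rule triangulation_pos)
  have QT: "Q \<in> T" using Q by (simp add: interior_square_def)
  let ?same = "Psi_dx h Q p $ 2 + Psi_dy h Q p $ 1 = 0"
  let ?other = "Psi_dx h Q p $ 1 = 0 \<and> Psi_dy h Q p $ 2 = 0 \<and> Psi_dx h Q p $ 2 = Psi_dy h Q p $ 1"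
  consider (apart) "vertices h Q \<inter> vertices h p = {}" | (eq) "p = Q"
    | (adj) s where "s \<in> {h, -h}" "p = Q + vector [s, 0] \<or> p = Q + vector [0, s]"
    | (diag) s t where "s \<in> {h, -h}" "t \<in> {h, -h}" "p = Q + vector [s, t]"
  proof (cases "vertices h Q \<inter> vertices h p = {}")
    case False
    then have "p$1 - Q$1 \<in> {0, h, -h}" "p$2 - Q$2 \<in> {0, h, -h}"
      by (auto simp: vertices_def vertex_defs point_eq_iff)
    moreover have "p = Q + vector [p$1 - Q$1, p$2 - Q$2]" by (simp add: point_eq_iff)
    ultimately show ?thesis
      using eq adj[of "p$1 - Q$1"] adj[of "p$2 - Q$2"] diag[of "p$1 - Q$1" "p$2 - Q$2"]
      by (auto simp: point_eq_iff)
  qed (rule apart)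
  then have "((p \<in> Red \<longleftrightarrow> Q \<in> Red) \<and> ?same) \<or> ((p \<in> Red \<longleftrightarrow> Q \<notin> Red) \<and> ?other) \<or> (?same \<and> ?other)"
  proof cases
    case apart
    have "hat_dx h V p = 0" "hat_dy h V p = 0" if "V \<in> vertices h Q" for V
      using hat_eq_0[of V h p] apart that by auto
    then have "Psi_dx h Q p = 0" "Psi_dy h Q p = 0"
      by (simp_all add: Psi_dx_def Psi_dy_def vertices_def)
    then show ?thesis by simp
  next
    case eq
    then have "p = Q + vector [0, 0]" by (simp add: point_eq_iff)
    with eq show ?thesis using Psi_gradient_diagonal[OF h, of 0 0 p Q] by simp
  next
    case adj
    then show ?thesis
      using Psi_gradient_adjacent[OF h adj] checkerboard_adjacent[OF chk QT p h adj] by blast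
  next
    case diag
    then show ?thesis
      using Psi_gradient_diagonal[OF h _ diag(3)] diagonal_same_colour[OF chk tri \<open>open \<Omega>\<close> Q p diag] by blast
  qed
  then show "(p \<in> Red \<longleftrightarrow> Q \<in> Red) \<Longrightarrow> ?same" "(p \<in> Red \<longleftrightarrow> Q \<notin> Red) \<Longrightarrow> ?other" by argo+
qed

theorem lemma4p1:
  fixes \<Omega> :: "(real^2) set" and h :: real and T Red Black :: "(real^2) set"
  assumes "polygonal_domain \<Omega>" and "simply_connected \<Omega>"
    and "square_triangulation \<Omega> h T"
    and "mesh_assumption \<Omega> h T"
    and "checkerboard h T Red Black"
  shows "\<forall>QR\<in>Red. \<forall>QK\<in>Black.
           interior_square \<Omega> h T QR \<longrightarrow> interior_square \<Omega> h T QK \<longrightarrow>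
           grad_inner h T (Psi \<Omega> h T QR) (Psi \<Omega> h T QK) = 0"
proof (intro ballI impI)
  fix R K assume RK: "R \<in> Red" "K \<in> Black" and R: "interior_square \<Omega> h T R" and K: "interior_square \<Omega> h T K"
  have dom: "open \<Omega>" "bounded \<Omega>" using assms(1) by (auto simp: polygonal_domain_def)
  note tri = assms(3) and chk = assms(5)
  have "K \<notin> Red" using RK chk by (auto simp: checkerboard_def)
  have "integral (square h p) (\<lambda>x. jacobian (Psi \<Omega> h T R) (at x) \<bullet> jacobian (Psi \<Omega> h T K) (at x)) = 0"
    if p: "p \<in> T" for p
  proof -
    \<comment> \<open>\<open>p\<close> has the colour of exactly one of the two squares.\<close>
    have orth: "Psi_dx h R p \<bullet> Psi_dx h K p + Psi_dy h R p \<bullet> Psi_dy h K p = 0"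
    proof (cases "p \<in> Red")
      case True
      have "Psi_dx h R p $ 2 = - Psi_dy h R p $ 1"
        using Psi_gradient_by_colour(1)[OF chk tri dom(1) R p] True RK by simp
      moreover have "Psi_dx h K p $ 1 = 0 \<and> Psi_dy h K p $ 2 = 0 \<and> Psi_dx h K p $ 2 = Psi_dy h K p $ 1"
        using Psi_gradient_by_colour(2)[OF chk tri dom(1) K p] True \<open>K \<notin> Red\<close> by simp
      ultimately show ?thesis by (simp add: inner_vec_def sum_2)
    next
      case False
      have "Psi_dx h K p $ 2 = - Psi_dy h K p $ 1"
        using Psi_gradient_by_colour(1)[OF chk tri dom(1) K p] False \<open>K \<notin> Red\<close> by simp
      moreover have "Psi_dx h R p $ 1 = 0 \<and> Psi_dy h R p $ 2 = 0 \<and> Psi_dx h R p $ 2 = Psi_dy h R p $ 1"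
        using Psi_gradient_by_colour(2)[OF chk tri dom(1) R p] False RK by simp
      ultimately show ?thesis by (simp add: inner_vec_def sum_2)
    qed
    have zero: "jacobian (Psi \<Omega> h T R) (at x) \<bullet> jacobian (Psi \<Omega> h T K) (at x) = 0"
      if x: "x \<in> interior (square h p)" for x
    proof -
      have "jacobian (Psi \<Omega> h T R) (at x) \<bullet> jacobian (Psi \<Omega> h T K) (at x)
          = (Psi_dx h R p \<bullet> Psi_dx h K p + Psi_dy h R p \<bullet> Psi_dy h K p) / (h * h)"
        unfolding inner_vec_def[of "jacobian _ _"]
        by (simp add: sum_2 Psi_jacobian[OF dom tri R p x] Psi_jacobian[OF dom tri K p x]
            inner_vec_def add_divide_distrib)
      then show ?thesis using orth by simp
    qed
    have "negligible (square h p - interior (square h p))"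
      unfolding interior_square_eq unfolding square_def by (rule negligible_frontier_interval)
    then have "integral (square h p) (\<lambda>x. jacobian (Psi \<Omega> h T R) (at x) \<bullet> jacobian (Psi \<Omega> h T K) (at x))
        = integral (square h p) (\<lambda>x. 0 :: real)"
      by (rule integral_spike) (use zero in auto)
    then show ?thesis by simp
  qed
  then show "grad_inner h T (Psi \<Omega> h T R) (Psi \<Omega> h T K) = 0"
    by (simp add: grad_inner_def)
qed

end
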